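(* For $1\le k\le n$, let $i_{n,k}$ be the number of skew-merged involutions of length $n$ whose longest increasing subsequence has length $k$. Then $$i_{n,k}=\binom{n-1}{k-1}.$$ Thus the total number $i_n$ of skew-merged involutions of length $n$ is $2^{n-1}$, and the sequence $(i_{n,k})_{1\le k\le n}$ is log-concave.
   Context: A permutation is skew-merged if it is the merge of an increasing and a decreasing sequence, i.e. its entries can be partitioned into an increasing subsequence and a decreasing subsequence; equivalently, it avoids the patterns $2143$ and $3412$. An involution of length $n$ is a permutation $\sigma$ of $\{1,\dots,n\}$ with $\sigma=\sigma^{-1}$ (including the identity). A finite sequence of positive real numbers $(a_k)$ is log-concave if $a_{k-1}a_{k+1}\le a_k^2$ for all indices $k$ such that $k-1$, $k$, $k+1$ are all in the index range. *)

theory Defs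
  imports Complex_Main "HOL-Combinatorics.Permutations"
begin

text \<open>
  A permutation of length \<open>n\<close> is a function \<open>\<sigma>\<close> with \<open>\<sigma> permutes {1..n}\<close>. A subsequence of
  \<open>\<sigma>\<close> is given by its set of positions \<open>A \<subseteq> {1..n}\<close>.
\<close>

text \<open>Either of the two parts may be empty.\<close>

definition skew_merged :: "nat \<Rightarrow> (nat \<Rightarrow> nat) \<Rightarrow> bool" where
  "skew_merged n \<sigma> \<longleftrightarrow>
     (\<exists>A B. A \<union> B = {1..n} \<and> A \<inter> B = {} \<and>
        monotone_on A (<) (<) \<sigma> \<and> monotone_on B (<) (>) \<sigma>)"

definition lis_length :: "nat \<Rightarrow> (nat \<Rightarrow> nat) \<Rightarrow> nat" where
  "lis_length n \<sigma> = Max {card A | A. A \<subseteq> {1..n} \<and> monotone_on A (<) (<) \<sigma>}"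

definition skew_merged_involutions :: "nat \<Rightarrow> (nat \<Rightarrow> nat) set" where
  "skew_merged_involutions n = {\<sigma>. \<sigma> permutes {1..n} \<and> \<sigma> = inv \<sigma> \<and> skew_merged n \<sigma>}"

definition num_skew_merged_inv :: "nat \<Rightarrow> nat" where
  "num_skew_merged_inv n = card (skew_merged_involutions n)"

definition num_skew_merged_inv_lis :: "nat \<Rightarrow> nat \<Rightarrow> nat" where
  "num_skew_merged_inv_lis n k = card {\<sigma> \<in> skew_merged_involutions n. lis_length n \<sigma> = k}"

text \<open>
  Log-concavity of the finite sequence \<open>a m, \<dots>, a n\<close>, including positivity of its terms. For
  \<open>k\<close> strictly between \<open>m\<close> and \<open>n\<close> the subtraction \<open>k - 1\<close> does not truncate.
\<close>

definition log_concave :: "nat \<Rightarrow> nat \<Rightarrow> (nat \<Rightarrow> real) \<Rightarrow> bool" where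
  "log_concave m n a \<longleftrightarrow>
     (\<forall>k\<in>{m..n}. a k > 0) \<and>
     (\<forall>k\<in>{m<..<n}. a (k - 1) * a (k + 1) \<le> (a k)\<^sup>2)"

end

theory Submission
  imports Defs
begin

text \<open>
  A skew-merged involution is the same thing as an involution that reverses the order of the
  points it moves (\<open>skew_merged_involutions_eq\<close>). Its two-cycles are therefore nested
  inside each other around a common centre, and everything else is fixed:
  if \<open>a\<^sub>1 < \<dots> < a\<^sub>m < b\<^sub>m < \<dots> < b\<^sub>1\<close>
  are the moved points, then \<open>a\<^sub>i\<close> and \<open>b\<^sub>i\<close> are exchanged.

  Such an involution is encoded by its descent set, which consists of the positions
  \<open>a\<^sub>i\<close> and \<open>b\<^sub>i - 1\<close>. The two positions \<open>a\<^sub>m\<close> and \<open>b\<^sub>m - 1\<close> may coincide, so both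
  parities of the number of descents occur, and every subset of \<open>{1..<n}\<close> is the descent set of
  exactly one such involution (\<open>bij_betw_descents\<close>). This gives \<open>2 ^ (n - 1)\<close> involutions.

  The descent set also determines the longest increasing subsequence. The positions are covered
  by an increasing subsequence and a decreasing one that cross in exactly one
  position, and the decreasing one has one element more than there are descents
  (\<open>increasing_decreasing_cross\<close>). Since any increasing subsequence meets a decreasing one
  at most once, the increasing one is longest, and its length is \<open>n\<close> minus the number
  of descents. Hence the involutions whose longest increasing subsequence has length \<open>k\<close> correspond
  to the \<open>(n - k)\<close>-subsets of an \<open>(n - 1)\<close>-element set, and log-concavity is that of a row of
  Pascal's triangle.

  The facts about descent sets are proved by peeling the interval from outside: either
  its left end is fixed, or its right end is fixed, or the two ends are exchanged.
\<close>

section \<open>Involutions reversing the order of their moved points\<close>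

text \<open>
  The ends of the interval are parameters because the inductive arguments remove them one by one.
\<close>

definition reversing_involutions :: "nat \<Rightarrow> nat \<Rightarrow> (nat \<Rightarrow> nat) set" where
  "reversing_involutions l u =
     {\<sigma>. {x. \<sigma> x \<noteq> x} \<subseteq> {l..u} \<and> (\<forall>x. \<sigma> (\<sigma> x) = x) \<and> monotone_on {x. \<sigma> x \<noteq> x} (<) (>) \<sigma>}"

lemma reversing_involutionsI:
  assumes "\<And>x. \<sigma> x \<noteq> x \<Longrightarrow> l \<le> x \<and> x \<le> u"
    and "\<And>x. \<sigma> (\<sigma> x) = x"
    and "\<And>x y. x < y \<Longrightarrow> \<sigma> x \<noteq> x \<Longrightarrow> \<sigma> y \<noteq> y \<Longrightarrow> \<sigma> y < \<sigma> x"
  shows "\<sigma> \<in> reversing_involutions l u"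
  using assms by (auto simp: reversing_involutions_def monotone_on_def)

lemma reversing_involutionsD:
  assumes "\<sigma> \<in> reversing_involutions l u"
  shows "\<sigma> x \<noteq> x \<Longrightarrow> l \<le> x \<and> x \<le> u"
    and "\<sigma> (\<sigma> x) = x"
    and "x < y \<Longrightarrow> \<sigma> x \<noteq> x \<Longrightarrow> \<sigma> y \<noteq> y \<Longrightarrow> \<sigma> y < \<sigma> x"
  using assms by (auto simp: reversing_involutions_def monotone_on_def)

lemma reversing_involutions_image:
  assumes "\<sigma> \<in> reversing_involutions l u" "l \<le> x" "x \<le> u"
  shows "l \<le> \<sigma> x" "\<sigma> x \<le> u"
  using reversing_involutionsD(1,2)[OF assms(1)] assms(2,3) by metis+

lemma reversing_involutions_permutes:
  assumes "\<sigma> \<in> reversing_involutions l u"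
  shows "\<sigma> permutes {l..u}"
  unfolding permutes_def using reversing_involutionsD(1,2)[OF assms]
  by (metis atLeastAtMost_iff)

text \<open>
  In a partition into an increasing part \<open>A\<close> and a decreasing part \<open>B\<close>, the two points of a
  two-cycle form an inversion, so \<open>A\<close> contains at most one of them. If two moved points
  \<open>x < y\<close> had \<open>\<sigma> x < \<sigma> y\<close>, then \<open>B\<close> could contain at most one of \<open>x, y\<close> and at most one of
  \<open>\<sigma> x, \<sigma> y\<close>. That leaves only the two crosswise distributions, and each of them
  is contradictory because the mixed comparisons of \<open>x\<close> with \<open>\<sigma> y\<close> and of \<open>y\<close> with \<open>\<sigma> x\<close> would have
  to agree and to disagree. Conversely, the fixed points are an increasing part and the moved
  points a decreasing one.
\<close>

lemma skew_merged_involutions_eq: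
  "skew_merged_involutions n = reversing_involutions 1 n"
proof (intro equalityI subsetI)
  fix \<sigma> assume "\<sigma> \<in> skew_merged_involutions n"
  then have perm: "\<sigma> permutes {1..n}" and inv: "\<sigma> = inv \<sigma>" and "skew_merged n \<sigma>"
    by (auto simp: skew_merged_involutions_def)
  then obtain A B where AB: "A \<union> B = {1..n}" "A \<inter> B = {}"
    and inc: "monotone_on A (<) (<) \<sigma>" and dec: "monotone_on B (<) (>) \<sigma>"
    by (auto simp: skew_merged_def)
  have invol: "\<sigma> (\<sigma> x) = x" for x
    using permutes_inverses(2)[OF perm, of x] inv by simp
  have supp: "1 \<le> x \<and> x \<le> n" if "\<sigma> x \<noteq> x" for x
    using perm that permutes_not_in by fastforce
  have mono_A: "\<sigma> x < \<sigma> y \<longleftrightarrow> x < y" if "x \<in> A" "y \<in> A" for x y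
    using inc that by (metis monotone_onD not_less_iff_gr_or_eq)
  have anti_B: "\<sigma> y < \<sigma> x \<longleftrightarrow> x < y" if "x \<in> B" "y \<in> B" for x y
    using dec that by (metis monotone_onD not_less_iff_gr_or_eq)
  have "\<sigma> y < \<sigma> x" if xy: "x < y" "\<sigma> x \<noteq> x" "\<sigma> y \<noteq> y" for x y
  proof (rule ccontr)
    assume "\<not> \<sigma> y < \<sigma> x"
    moreover have "\<sigma> x \<noteq> \<sigma> y" using xy(1) invol by (metis less_irrefl)
    ultimately have less: "\<sigma> x < \<sigma> y" by simp
    have mem: "z \<in> A \<or> z \<in> B" if "\<sigma> z \<noteq> z" for z
      using supp[OF that] unfolding Un_iff[symmetric] AB(1) by simp
    have mem': "x \<in> A \<or> x \<in> B" "\<sigma> x \<in> A \<or> \<sigma> x \<in> B" "y \<in> A \<or> y \<in> B" "\<sigma> y \<in> A \<or> \<sigma> y \<in> B"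
      using mem xy invol by metis+
    have "\<not> (z \<in> A \<and> \<sigma> z \<in> A)" if "\<sigma> z \<noteq> z" for z
      using mono_A[of z "\<sigma> z"] invol[of z] that by auto
    then have cyc: "\<not> (x \<in> A \<and> \<sigma> x \<in> A)" "\<not> (y \<in> A \<and> \<sigma> y \<in> A)" using xy by auto
    have notB: "\<not> (x \<in> B \<and> y \<in> B)" "\<not> (\<sigma> x \<in> B \<and> \<sigma> y \<in> B)"
      using anti_B[of x y] anti_B[of "\<sigma> x" "\<sigma> y"] xy less invol by auto
    have "x \<noteq> \<sigma> y" using xy less invol by (metis less_asym)
    consider "x \<in> B" "\<sigma> y \<in> B" "y \<in> A" "\<sigma> x \<in> A" | "y \<in> B" "\<sigma> x \<in> B" "x \<in> A" "\<sigma> y \<in> A"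
      using mem' cyc notB by blast
    then show False
    proof cases
      case 1
      have "x < \<sigma> y \<longleftrightarrow> y < \<sigma> x" using anti_B[OF 1(1,2)] invol by simp
      moreover have "y < \<sigma> x \<longleftrightarrow> \<sigma> y < x" using mono_A[OF 1(3,4)] invol by simp
      ultimately show False using \<open>x \<noteq> \<sigma> y\<close> by linarith
    next
      case 2
      have "y < \<sigma> x \<longleftrightarrow> x < \<sigma> y" using anti_B[OF 2(1,2)] invol by simp
      moreover have "x < \<sigma> y \<longleftrightarrow> \<sigma> x < y" using mono_A[OF 2(3,4)] invol by simp
      moreover have "y \<noteq> \<sigma> x" using \<open>x \<noteq> \<sigma> y\<close> invol by metis
      ultimately show False by linarith
    qed
  qed
  then show "\<sigma> \<in> reversing_involutions 1 n"
    using supp invol by (intro reversing_involutionsI) auto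
next
  fix \<sigma> assume \<sigma>: "\<sigma> \<in> reversing_involutions 1 n"
  let ?A = "{x \<in> {1..n}. \<sigma> x = x}" and ?B = "{x \<in> {1..n}. \<sigma> x \<noteq> x}"
  have "\<sigma> = inv \<sigma>"
    using reversing_involutionsD(2)[OF \<sigma>] by (intro inv_equality[symmetric]) auto
  moreover have "monotone_on ?A (<) (<) \<sigma>" "monotone_on ?B (<) (>) \<sigma>"
    using reversing_involutionsD(3)[OF \<sigma>] by (auto simp: monotone_on_def)
  moreover have "?A \<union> ?B = {1..n}" "?A \<inter> ?B = {}" by auto
  ultimately show "\<sigma> \<in> skew_merged_involutions n"
    using reversing_involutions_permutes[OF \<sigma>]
    unfolding skew_merged_involutions_def skew_merged_def by blast
qed

lemma reversing_involutions_fix_left: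
  assumes "l \<le> u"
  shows "\<sigma> \<in> reversing_involutions (Suc l) u \<longleftrightarrow> \<sigma> \<in> reversing_involutions l u \<and> \<sigma> l = l"
proof -
  have "{x. \<sigma> x \<noteq> x} \<subseteq> {Suc l..u} \<longleftrightarrow> {x. \<sigma> x \<noteq> x} \<subseteq> {l..u} \<and> \<sigma> l = l"
    unfolding atLeastAtMost_insertL[OF assms, symmetric] by auto
  then show ?thesis by (auto simp: reversing_involutions_def)
qed

lemma reversing_involutions_fix_right:
  assumes "l \<le> Suc v"
  shows "\<sigma> \<in> reversing_involutions l v \<longleftrightarrow> \<sigma> \<in> reversing_involutions l (Suc v) \<and> \<sigma> (Suc v) = Suc v"
proof -
  have "{x. \<sigma> x \<noteq> x} \<subseteq> {l..v} \<longleftrightarrow> {x. \<sigma> x \<noteq> x} \<subseteq> {l..Suc v} \<and> \<sigma> (Suc v) = Suc v"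
    unfolding atLeastAtMostSuc_conv[OF assms] by auto
  then show ?thesis by (auto simp: reversing_involutions_def)
qed

text \<open>
  The outermost moved points form a two-cycle: the map reverses the order of the moved points,
  so it exchanges the smallest and the largest of them.
\<close>

lemma reversing_involutions_moved_ends:
  assumes \<sigma>: "\<sigma> \<in> reversing_involutions l u" and "l < u" "\<sigma> l \<noteq> l" "\<sigma> u \<noteq> u"
  shows "\<sigma> l = u" "\<sigma> u = l"
proof -
  note D = reversing_involutionsD[OF \<sigma>]
  have "\<sigma> u = l"
  proof (rule ccontr)
    assume ne: "\<sigma> u \<noteq> l"
    have "\<sigma> l \<noteq> u" using ne D(2) by metis
    then have "\<sigma> l < u" using reversing_involutions_image(2)[OF \<sigma>, of l] assms(2) by simp
    then have "\<sigma> u < \<sigma> (\<sigma> l)" using D(3)[of "\<sigma> l" u] assms(3,4) D(2)[of l] by simp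
    then show False using reversing_involutions_image(1)[OF \<sigma>, of u] assms(2) D(2)[of l] by simp
  qed
  then show "\<sigma> u = l" "\<sigma> l = u" using D(2) by metis+
qed

lemma reversing_involutions_unswap:
  assumes \<sigma>: "\<sigma> \<in> reversing_involutions l (Suc v)" and "\<sigma> l = Suc v" "\<sigma> (Suc v) = l"
  shows "\<sigma>(l := l, Suc v := Suc v) \<in> reversing_involutions (Suc l) v"
proof (rule reversing_involutionsI)
  note D = reversing_involutionsD[OF \<sigma>]
  let ?\<tau> = "\<sigma>(l := l, Suc v := Suc v)"
  show "Suc l \<le> x \<and> x \<le> v" if "?\<tau> x \<noteq> x" for x
    using that D(1)[of x] by (auto split: if_splits)
  show "?\<tau> (?\<tau> x) = x" for x
    using D(2) assms(2,3) by (auto; metis)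
  show "?\<tau> y < ?\<tau> x" if "x < y" "?\<tau> x \<noteq> x" "?\<tau> y \<noteq> y" for x y
    using that D(3)[of x y] by (auto split: if_splits)
qed

lemma reversing_involutions_swap:
  assumes \<tau>: "\<tau> \<in> reversing_involutions (Suc l) v" and "l \<le> v"
  shows "\<tau>(l := Suc v, Suc v := l) \<in> reversing_involutions l (Suc v)"
proof (rule reversing_involutionsI)
  note D = reversing_involutionsD[OF \<tau>]
  let ?\<sigma> = "\<tau>(l := Suc v, Suc v := l)"
  have fix_ends: "\<tau> l = l" "\<tau> (Suc v) = Suc v" using D(1) by fastforce+
  have ne: "\<tau> x \<noteq> l" "\<tau> x \<noteq> Suc v" if "x \<noteq> l" "x \<noteq> Suc v" for x
    using that fix_ends D(2) by metis+
  show "l \<le> x \<and> x \<le> Suc v" if "?\<sigma> x \<noteq> x" for x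
    using that D(1)[of x] \<open>l \<le> v\<close> by (auto split: if_splits)
  show "?\<sigma> (?\<sigma> x) = x" for x
    using D(2) ne \<open>l \<le> v\<close> by auto
  have inside: "l < \<tau> x \<and> \<tau> x < Suc v" if "\<tau> x \<noteq> x" for x
    using D(1)[of "\<tau> x"] D(2)[of x] that by auto
  show "?\<sigma> y < ?\<sigma> x" if "x < y" "?\<sigma> x \<noteq> x" "?\<sigma> y \<noteq> y" for x y
    using that D(1)[of x] D(1)[of y] D(3)[of x y] inside[of x] inside[of y] \<open>l \<le> v\<close>
    by (auto split: if_splits)
qed

section \<open>Descent sets\<close>

definition descents :: "nat \<Rightarrow> nat \<Rightarrow> (nat \<Rightarrow> nat) \<Rightarrow> nat set" where
  "descents l u \<sigma> = {i \<in> {l..<u}. \<sigma> (Suc i) < \<sigma> i}"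

lemma descents_fix_left:
  assumes "\<sigma> \<in> reversing_involutions l u" "l < u" "\<sigma> l = l"
  shows "descents l u \<sigma> = descents (Suc l) u \<sigma>"
proof -
  have "{l..<u} = insert l {Suc l..<u}" using assms(2) by auto
  then show ?thesis
    using assms reversing_involutions_image(1)[OF assms(1), of "Suc l"] by (auto simp: descents_def)
qed

lemma descents_fix_right:
  assumes "\<sigma> \<in> reversing_involutions l (Suc v)" "l \<le> v" "\<sigma> (Suc v) = Suc v"
  shows "descents l (Suc v) \<sigma> = descents l v \<sigma>"
  using assms reversing_involutions_image(2)[OF assms(1), of v]
  by (auto simp: descents_def less_Suc_eq)

lemma descents_swap:
  assumes \<sigma>: "\<sigma> \<in> reversing_involutions l (Suc v)" and "l \<le> v" "\<sigma> l = Suc v" "\<sigma> (Suc v) = l"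
  shows "descents l (Suc v) \<sigma> =
    insert l (insert v (descents (Suc l) v (\<sigma>(l := l, Suc v := Suc v))))"
proof -
  note D = reversing_involutionsD[OF \<sigma>]
  have "\<sigma> (Suc l) < Suc v"
    using reversing_involutions_image(2)[OF \<sigma>, of "Suc l"] D(2)[of "Suc l"] assms
    by (metis Suc_le_mono le_SucI le_neq_implies_less n_not_Suc_n order.refl)
  moreover have "l < \<sigma> v"
    using reversing_involutions_image(1)[OF \<sigma>, of v] D(2)[of v] assms
    by (metis le_SucI le_neq_implies_less n_not_Suc_n order.refl)
  moreover have "{l..<Suc v} = insert l (insert v {Suc l..<v})" using assms(2) by auto
  ultimately show ?thesis using assms(2-4)
    by (cases "l = v") (auto simp: descents_def)
qed

text \<open>
  This and its mirror image let the descent set reveal which of the three ways of peeling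
  applies; hence two involutions with equal descent sets can be peeled in parallel.
\<close>

lemma descent_left_iff:
  assumes "\<sigma> \<in> reversing_involutions l u" "l < u"
  shows "l \<in> descents l u \<sigma> \<longleftrightarrow> \<sigma> l \<noteq> l"
proof
  assume "l \<in> descents l u \<sigma>"
  then show "\<sigma> l \<noteq> l" using reversing_involutions_image(1)[OF assms(1), of "Suc l"] assms
    by (auto simp: descents_def)
next
  note D = reversing_involutionsD[OF assms(1)]
  assume "\<sigma> l \<noteq> l"
  then have "l < \<sigma> l" using reversing_involutions_image(1)[OF assms(1), of l] assms(2) by simp
  have "\<sigma> (Suc l) < \<sigma> l"
  proof (cases "\<sigma> (Suc l) = Suc l")
    case True
    then have "\<sigma> l \<noteq> Suc l" using D(2) by (metis n_not_Suc_n)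
    then show ?thesis using True \<open>l < \<sigma> l\<close> by simp
  next
    case False
    then show ?thesis using D(3)[of l "Suc l"] \<open>\<sigma> l \<noteq> l\<close> by simp
  qed
  then show "l \<in> descents l u \<sigma>" using assms by (simp add: descents_def)
qed

lemma descent_right_iff:
  assumes "\<sigma> \<in> reversing_involutions l (Suc v)" "l \<le> v"
  shows "v \<in> descents l (Suc v) \<sigma> \<longleftrightarrow> \<sigma> (Suc v) \<noteq> Suc v"
proof
  assume "v \<in> descents l (Suc v) \<sigma>"
  then show "\<sigma> (Suc v) \<noteq> Suc v" using reversing_involutions_image(2)[OF assms(1), of v] assms
    by (auto simp: descents_def)
next
  note D = reversing_involutionsD[OF assms(1)]
  assume ne: "\<sigma> (Suc v) \<noteq> Suc v"
  then have "\<sigma> (Suc v) < Suc v"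
    using reversing_involutions_image(2)[OF assms(1), of "Suc v"] assms(2) by simp
  have "\<sigma> (Suc v) < \<sigma> v"
  proof (cases "\<sigma> v = v")
    case True
    then have "\<sigma> (Suc v) \<noteq> v" using D(2) by (metis n_not_Suc_n)
    then show ?thesis using True \<open>\<sigma> (Suc v) < Suc v\<close> by simp
  next
    case False
    then show ?thesis using D(3)[of v "Suc v"] ne by simp
  qed
  then show "v \<in> descents l (Suc v) \<sigma>" using assms by (simp add: descents_def)
qed

lemma interval_peel_induct [case_names short peel]:
  fixes l u :: nat
  assumes short: "\<And>l u. u \<le> l \<Longrightarrow> P l u"
    and peel: "\<And>l v. l \<le> v \<Longrightarrow> P (Suc l) (Suc v) \<Longrightarrow> P l v \<Longrightarrow> P (Suc l) v \<Longrightarrow> P l (Suc v)"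
  shows "P l u"
proof (induction "u - l" arbitrary: l u rule: less_induct)
  case less
  show ?case
  proof (cases "u \<le> l")
    case False
    then obtain v where "u = Suc v" "l \<le> v" by (cases u) auto
    then show ?thesis using less.hyps peel[of l v] by simp
  qed (rule short)
qed

text \<open>
  The case of an empty interval arises when the two ends of an interval of two points are
  peeled off.
\<close>

lemma reversing_involutions_short:
  assumes "u \<le> l"
  shows "reversing_involutions l u = {id}"
proof -
  have "\<sigma> = id" if "\<sigma> \<in> reversing_involutions l u" for \<sigma>
  proof
    fix x
    note D = reversing_involutionsD[OF that]
    have "\<sigma> x = x"
    proof (rule ccontr)
      assume "\<sigma> x \<noteq> x"
      then have "\<sigma> (\<sigma> x) \<noteq> \<sigma> x" using D(2)[of x] by simp
      then show False using D(1)[of x] D(1)[of "\<sigma> x"] \<open>\<sigma> x \<noteq> x\<close> assms by linarith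
    qed
    then show "\<sigma> x = id x" by simp
  qed
  then show ?thesis by (auto simp: reversing_involutions_def)
qed

section \<open>An involution for each descent set\<close>

lemma descents_inj:
  "\<sigma> \<in> reversing_involutions l u \<Longrightarrow> \<tau> \<in> reversing_involutions l u \<Longrightarrow>
    descents l u \<sigma> = descents l u \<tau> \<Longrightarrow> \<sigma> = \<tau>"
proof (induction l u arbitrary: \<sigma> \<tau> rule: interval_peel_induct)
  case (short l u)
  then show ?case by (simp add: reversing_involutions_short)
next
  case (peel l v)
  note \<sigma> = peel.prems(1) and \<tau> = peel.prems(2) and eq = peel.prems(3)
  have lv: "l < Suc v" using peel.hyps by simp
  have left: "\<sigma> l = l \<longleftrightarrow> \<tau> l = l"
    using descent_left_iff[OF \<sigma> lv] descent_left_iff[OF \<tau> lv] eq by auto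
  have right: "\<sigma> (Suc v) = Suc v \<longleftrightarrow> \<tau> (Suc v) = Suc v"
    using descent_right_iff[OF \<sigma> peel.hyps] descent_right_iff[OF \<tau> peel.hyps] eq by auto
  consider "\<sigma> l = l" | "\<sigma> (Suc v) = Suc v" | "\<sigma> l \<noteq> l" "\<sigma> (Suc v) \<noteq> Suc v" by blast
  then show ?case
  proof cases
    case 1
    then show ?thesis using peel.IH(1)[of \<sigma> \<tau>] \<sigma> \<tau> eq left lv
      by (simp add: reversing_involutions_fix_left descents_fix_left)
  next
    case 2
    then have \<tau>_fix: "\<tau> (Suc v) = Suc v" using right by simp
    have "descents l v \<sigma> = descents l v \<tau>"
      using eq descents_fix_right[OF \<sigma> peel.hyps 2] descents_fix_right[OF \<tau> peel.hyps \<tau>_fix] by simp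
    moreover have "\<sigma> \<in> reversing_involutions l v" "\<tau> \<in> reversing_involutions l v"
      using \<sigma> \<tau> 2 \<tau>_fix reversing_involutions_fix_right[of l v] peel.hyps by auto
    ultimately show ?thesis using peel.IH(2) by blast
  next
    case 3
    let ?in = "\<lambda>f :: nat \<Rightarrow> nat. f(l := l, Suc v := Suc v)"
    have \<sigma>_ends: "\<sigma> l = Suc v" "\<sigma> (Suc v) = l"
      using reversing_involutions_moved_ends[OF \<sigma> lv 3] .
    have \<tau>_ends: "\<tau> l = Suc v" "\<tau> (Suc v) = l"
      using reversing_involutions_moved_ends[OF \<tau> lv] 3 left right by auto
    \<comment> \<open>The two ends contribute \<open>l\<close> and \<open>v\<close>, which lie outside the descents of the inner interval
      and can therefore be cancelled.\<close>
    have "descents (Suc l) v f = descents l (Suc v) \<sigma> - {l, v}"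
      if "descents l (Suc v) \<sigma> = insert l (insert v (descents (Suc l) v f))" for f
      using that by (auto simp: descents_def)
    then have "descents (Suc l) v (?in \<sigma>) = descents (Suc l) v (?in \<tau>)"
      using descents_swap[OF \<sigma> peel.hyps \<sigma>_ends] descents_swap[OF \<tau> peel.hyps \<tau>_ends] eq by metis
    then have in_eq: "?in \<sigma> = ?in \<tau>"
      using peel.IH(3) reversing_involutions_unswap[OF \<sigma> \<sigma>_ends]
        reversing_involutions_unswap[OF \<tau> \<tau>_ends] by blast
    show ?thesis
    proof
      fix x show "\<sigma> x = \<tau> x"
        using fun_cong[OF in_eq, of x] \<sigma>_ends \<tau>_ends by (auto split: if_splits)
    qed
  qed
qed

lemma descents_surj:
  "C \<subseteq> {l..<u} \<Longrightarrow> \<exists>\<sigma>\<in>reversing_involutions l u. descents l u \<sigma> = C"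
proof (induction l u arbitrary: C rule: interval_peel_induct)
  case (short l u)
  then show ?case by (auto simp: reversing_involutions_short descents_def)
next
  case (peel l v)
  consider "l \<notin> C" | "v \<notin> C" | "l \<in> C" "v \<in> C" by blast
  then show ?case
  proof cases
    case 1
    then have "C \<subseteq> {Suc l..<Suc v}" using peel.prems by (auto simp: Suc_le_eq subset_iff intro: le_neq_implies_less)
    then obtain \<sigma> where "\<sigma> \<in> reversing_involutions (Suc l) (Suc v)" "descents (Suc l) (Suc v) \<sigma> = C"
      using peel.IH(1) by blast
    then show ?thesis using peel.hyps
      by (intro bexI[of _ \<sigma>]) (auto simp: reversing_involutions_fix_left descents_fix_left)
  next
    case 2
    then have "C \<subseteq> {l..<v}" using peel.prems by (force simp: less_Suc_eq)
    then obtain \<sigma> where \<sigma>: "\<sigma> \<in> reversing_involutions l v" "descents l v \<sigma> = C"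
      using peel.IH(2) by blast
    then have "\<sigma> \<in> reversing_involutions l (Suc v)" "\<sigma> (Suc v) = Suc v"
      using reversing_involutions_fix_right[of l v \<sigma>] peel.hyps by simp_all
    then show ?thesis using descents_fix_right[OF _ peel.hyps] \<sigma>(2) by blast
  next
    case 3
    have "C - {l, v} \<subseteq> {Suc l..<v}" using peel.prems by force
    then obtain \<tau> where \<tau>: "\<tau> \<in> reversing_involutions (Suc l) v" "descents (Suc l) v \<tau> = C - {l, v}"
      using peel.IH(3) by blast
    let ?\<sigma> = "\<tau>(l := Suc v, Suc v := l)"
    have \<sigma>: "?\<sigma> \<in> reversing_involutions l (Suc v)"
      using reversing_involutions_swap[OF \<tau>(1) peel.hyps] .
    have "\<tau> l = l" "\<tau> (Suc v) = Suc v" using reversing_involutionsD(1)[OF \<tau>(1)] by fastforce+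
    then have "?\<sigma>(l := l, Suc v := Suc v) = \<tau>" by auto
    then have "descents l (Suc v) ?\<sigma> = C"
      using descents_swap[OF \<sigma> peel.hyps] peel.hyps \<tau>(2) 3 by auto
    then show ?thesis using \<sigma> by blast
  qed
qed

lemma bij_betw_descents:
  "bij_betw (descents l u) (reversing_involutions l u) (Pow {l..<u})"
proof (rule bij_betwI')
  fix \<sigma> \<tau> assume "\<sigma> \<in> reversing_involutions l u" "\<tau> \<in> reversing_involutions l u"
  then show "descents l u \<sigma> = descents l u \<tau> \<longleftrightarrow> \<sigma> = \<tau>" using descents_inj by blast
next
  fix C assume "C \<in> Pow {l..<u}"
  then show "\<exists>\<sigma>\<in>reversing_involutions l u. C = descents l u \<sigma>" using descents_surj by blast
qed (auto simp: descents_def)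

section \<open>The longest increasing subsequence\<close>

text \<open>
  A fixed end extends the increasing part and creates no descent; an exchanged pair of ends
  extends the decreasing part by two and creates two descents. The crossing point
  stays where it started, at the innermost stage: a single fixed point, or else two adjacent points
  that are exchanged, where one descent belongs to two decreasing points.
\<close>

lemma increasing_decreasing_cross:
  "l \<le> u \<Longrightarrow> \<sigma> \<in> reversing_involutions l u \<Longrightarrow>
    \<exists>A B c. A \<union> B = {l..u} \<and> A \<inter> B = {c} \<and> monotone_on A (<) (<) \<sigma> \<and> monotone_on B (<) (>) \<sigma>
      \<and> card B = Suc (card (descents l u \<sigma>))"
proof (induction l u arbitrary: \<sigma> rule: interval_peel_induct)
  case (short l u)
  then have "u = l" by simp
  then show ?case
    by (intro exI[of _ "{l}"] exI[of _ l]) (auto simp: monotone_on_def descents_def)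
next
  case (peel l v)
  note \<sigma> = peel.prems(2)
  have lv: "l < Suc v" using peel.hyps by simp
  consider "\<sigma> l = l" | "\<sigma> (Suc v) = Suc v" | "\<sigma> l \<noteq> l" "\<sigma> (Suc v) \<noteq> Suc v" by blast
  then show ?case
  proof cases
    case 1
    then have \<sigma>': "\<sigma> \<in> reversing_involutions (Suc l) (Suc v)"
      using \<sigma> lv by (simp add: reversing_involutions_fix_left)
    obtain A B c where AB: "A \<union> B = {Suc l..Suc v}" "A \<inter> B = {c}" "monotone_on A (<) (<) \<sigma>"
        "monotone_on B (<) (>) \<sigma>" "card B = Suc (card (descents (Suc l) (Suc v) \<sigma>))"
      using peel.IH(1)[OF _ \<sigma>'] lv by auto
    have sub: "A \<subseteq> {Suc l..Suc v}" "B \<subseteq> {Suc l..Suc v}" using AB(1) by auto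
    then have "l < \<sigma> x" if "x \<in> A" for x
      using reversing_involutions_image(1)[OF \<sigma>', of x] that by force
    then have "monotone_on (insert l A) (<) (<) \<sigma>"
      using AB(3) sub 1 by (force simp: monotone_on_def)
    moreover have "insert l A \<union> B = {l..Suc v}" using AB(1) lv by force
    moreover have "insert l A \<inter> B = {c}" using AB(2) sub by force
    ultimately show ?thesis using AB(4,5) descents_fix_left[OF \<sigma> lv 1] by metis
  next
    case 2
    then have \<sigma>': "\<sigma> \<in> reversing_involutions l v"
      using \<sigma> reversing_involutions_fix_right[of l v \<sigma>] peel.hyps by simp
    obtain A B c where AB: "A \<union> B = {l..v}" "A \<inter> B = {c}" "monotone_on A (<) (<) \<sigma>"
        "monotone_on B (<) (>) \<sigma>" "card B = Suc (card (descents l v \<sigma>))"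
      using peel.IH(2)[OF _ \<sigma>'] peel.hyps by auto
    have sub: "A \<subseteq> {l..v}" "B \<subseteq> {l..v}" using AB(1) by auto
    then have "\<sigma> x < Suc v" if "x \<in> A" for x
      using reversing_involutions_image(2)[OF \<sigma>', of x] that by force
    then have "monotone_on (insert (Suc v) A) (<) (<) \<sigma>"
      using AB(3) sub 2 by (force simp: monotone_on_def)
    moreover have "insert (Suc v) A \<union> B = {l..Suc v}" using AB(1) peel.hyps by force
    moreover have "insert (Suc v) A \<inter> B = {c}" using AB(2) sub by force
    ultimately show ?thesis using AB(4,5) descents_fix_right[OF \<sigma> peel.hyps 2] by metis
  next
    case 3
    have ends: "\<sigma> l = Suc v" "\<sigma> (Suc v) = l"
      using reversing_involutions_moved_ends[OF \<sigma> lv 3] .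
    let ?\<tau> = "\<sigma>(l := l, Suc v := Suc v)"
    have \<tau>: "?\<tau> \<in> reversing_involutions (Suc l) v"
      using reversing_involutions_unswap[OF \<sigma> ends] .
    note desc = descents_swap[OF \<sigma> peel.hyps ends]
    show ?thesis
    proof (cases "l = v")
      case True
      then have "descents l (Suc v) \<sigma> = {l}" using desc by (auto simp: descents_def)
      moreover have "{l} \<union> {l, Suc v} = {l..Suc v}" using True by auto
      moreover have "monotone_on {l, Suc v} (<) (>) \<sigma>" using ends lv by (simp add: monotone_on_def)
      moreover have "{l} \<inter> {l, Suc v} = {l}" "monotone_on {l} (<) (<) \<sigma>"
        by (auto simp: monotone_on_def)
      moreover have "card {l, Suc v} = Suc (card {l})" using lv by simp
      ultimately show ?thesis by metis
    next
      case False
      then obtain A B c where AB: "A \<union> B = {Suc l..v}" "A \<inter> B = {c}"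
          "monotone_on A (<) (<) ?\<tau>" "monotone_on B (<) (>) ?\<tau>"
          "card B = Suc (card (descents (Suc l) v ?\<tau>))"
        using peel.IH(3)[OF _ \<tau>] peel.hyps le_neq_implies_less Suc_leI by meson
      let ?B = "insert l (insert (Suc v) B)"
      have sub: "A \<subseteq> {Suc l..v}" "B \<subseteq> {Suc l..v}" using AB(1) by auto
      have in_eq: "?\<tau> x = \<sigma> x" if "x \<in> {Suc l..v}" for x using that by auto
      have "monotone_on A (<) (<) \<sigma>"
        using AB(3) sub(1) in_eq unfolding monotone_on_def by (metis subsetD)
      moreover have "monotone_on B (<) (>) \<sigma>"
        using AB(4) sub(2) in_eq unfolding monotone_on_def by (metis subsetD)
      moreover have "l < \<sigma> x \<and> \<sigma> x < Suc v" if "x \<in> B" for x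
        using reversing_involutions_image[OF \<tau>, of x] in_eq[of x] that sub(2) by force
      ultimately have "monotone_on ?B (<) (>) \<sigma>"
        using sub(2) ends lv by (force simp: monotone_on_def)
      moreover have "A \<union> ?B = {l..Suc v}" using AB(1) lv by force
      moreover have "A \<inter> ?B = {c}" using AB(2) sub by force
      moreover have "card ?B = Suc (card (descents l (Suc v) \<sigma>))"
      proof -
        have "finite B" using sub(2) finite_subset by blast
        moreover have "l \<notin> B" "Suc v \<notin> B" using sub(2) by auto
        ultimately have "card ?B = Suc (Suc (card B))" using lv by simp
        moreover have "finite (descents (Suc l) v ?\<tau>)" "l \<notin> descents (Suc l) v ?\<tau>"
          "v \<notin> descents (Suc l) v ?\<tau>" by (auto simp: descents_def)
        ultimately show ?thesis using AB(5) False desc by simp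
      qed
      ultimately show ?thesis using \<open>monotone_on A (<) (<) \<sigma>\<close> by metis
    qed
  qed
qed

text \<open>
  The crossing makes the sizes of \<open>A\<close> and \<open>B\<close> add up to \<open>n + 1\<close>. Any increasing \<open>X\<close> meets \<open>B\<close>
  in at most one position, so the sizes of \<open>X\<close> and \<open>B\<close> add up to at most that.
\<close>

lemma lis_length_eq:
  assumes "n \<ge> 1" and \<sigma>: "\<sigma> \<in> reversing_involutions 1 n"
  shows "lis_length n \<sigma> = n - card (descents 1 n \<sigma>)"
proof -
  obtain A B c where AB: "A \<union> B = {1..n}" "A \<inter> B = {c}" "monotone_on A (<) (<) \<sigma>"
      "monotone_on B (<) (>) \<sigma>" "card B = Suc (card (descents 1 n \<sigma>))"
    using increasing_decreasing_cross[OF assms] by blast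
  have fin: "finite X" if "X \<subseteq> {1..n}" for X using that finite_subset by blast
  have sub: "A \<subseteq> {1..n}" "B \<subseteq> {1..n}" using AB(1) by auto
  have "card A + card B = n + 1"
    using card_Un_Int[of A B] fin sub AB(1,2) by simp
  then have card_A: "card A = n - card (descents 1 n \<sigma>)" using AB(5) by simp
  have bound: "card X \<le> card A" if X: "X \<subseteq> {1..n}" "monotone_on X (<) (<) \<sigma>" for X
  proof -
    have "x = y" if "x \<in> X \<inter> B" "y \<in> X \<inter> B" for x y
      using that X(2) AB(4) by (metis IntD1 IntD2 linorder_neqE_nat monotone_onD less_asym)
    then have "card (X \<inter> B) \<le> 1"
      using fin[OF X(1)] by (simp add: card_le_Suc0_iff_eq)
    moreover have "card (X \<union> B) \<le> n"
      using card_mono[of "{1..n}" "X \<union> B"] X(1) sub(2) by simp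
    ultimately show ?thesis
      using card_Un_Int[of X B] fin X(1) sub(2) \<open>card A + card B = n + 1\<close> by simp
  qed
  have "Max {card X | X. X \<subseteq> {1..n} \<and> monotone_on X (<) (<) \<sigma>} = card A"
  proof (rule Max_eqI)
    show "finite {card X | X. X \<subseteq> {1..n} \<and> monotone_on X (<) (<) \<sigma>}"
      using bound by (auto intro: finite_subset[of _ "{..card A}"])
  qed (use bound sub(1) AB(3) in auto)
  then show ?thesis unfolding lis_length_def card_A .
qed

section \<open>Counting\<close>

lemma num_skew_merged_inv_eq:
  "num_skew_merged_inv n = 2 ^ (n - 1)"
  using bij_betw_same_card[OF bij_betw_descents[of 1 n]]
  by (simp add: num_skew_merged_inv_def skew_merged_involutions_eq card_Pow)

lemma num_skew_merged_inv_lis_eq: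
  assumes "1 \<le> k" "k \<le> n"
  shows "num_skew_merged_inv_lis n k = (n - 1) choose (k - 1)"
proof -
  let ?S = "{\<sigma> \<in> reversing_involutions 1 n. lis_length n \<sigma> = k}"
  let ?T = "{C. C \<subseteq> {1..<n} \<and> card C = n - k}"
  have small: "card C \<le> n - 1" if "C \<subseteq> {1..<n}" for C
    using card_mono[OF _ that] by simp
  have "lis_length n \<sigma> = k \<longleftrightarrow> card (descents 1 n \<sigma>) = n - k"
    if "\<sigma> \<in> reversing_involutions 1 n" for \<sigma>
    using lis_length_eq[OF _ that] small[of "descents 1 n \<sigma>"] assms
    by (auto simp: descents_def)
  then have S_eq: "?S = {\<sigma> \<in> reversing_involutions 1 n. descents 1 n \<sigma> \<in> ?T}"
    by (auto simp: descents_def)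
  have bij: "bij_betw (descents 1 n) {\<sigma> \<in> reversing_involutions 1 n. descents 1 n \<sigma> \<in> ?T} ?T"
  proof (rule bij_betw_imageI)
    show "inj_on (descents 1 n) {\<sigma> \<in> reversing_involutions 1 n. descents 1 n \<sigma> \<in> ?T}"
      using bij_betw_imp_inj_on[OF bij_betw_descents[of 1 n]] by (rule inj_on_subset) auto
    have "descents 1 n ` {\<sigma> \<in> reversing_involutions 1 n. descents 1 n \<sigma> \<in> ?T}
        = descents 1 n ` reversing_involutions 1 n \<inter> ?T" by auto
    also have "\<dots> = Pow {1..<n} \<inter> ?T"
      by (simp only: bij_betw_imp_surj_on[OF bij_betw_descents])
    also have "\<dots> = ?T" by auto
    finally show "descents 1 n ` {\<sigma> \<in> reversing_involutions 1 n. descents 1 n \<sigma> \<in> ?T} = ?T" .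
  qed
  have "card ?S = card ?T" unfolding S_eq by (rule bij_betw_same_card[OF bij])
  also have "\<dots> = (n - 1) choose (n - k)" using n_subsets[of "{1..<n}"] by simp
  also have "\<dots> = (n - 1) choose (k - 1)"
    using binomial_symmetric[of "k - 1" "n - 1"] assms by simp
  finally show ?thesis
    by (simp add: num_skew_merged_inv_lis_def skew_merged_involutions_eq)
qed

text \<open>
  The ratio of successive binomial coefficients, \<open>(m - j) / (j + 1)\<close>, decreases in \<open>j\<close>. The ratios
  are cleared of denominators to stay in the natural numbers.
\<close>

lemma binomial_log_concave:
  fixes m j :: nat
  shows "(m choose j) * (m choose (j + 2)) \<le> (m choose (j + 1))\<^sup>2"
proof -
  let ?a = "m choose j" and ?b = "m choose (j + 1)" and ?c = "m choose (j + 2)"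
  have ab: "(j + 1) * ?b = (m - j) * ?a"
    using binomial_absorb_comp[of m j] binomial_absorption[of j m] by simp
  have bc: "(j + 2) * ?c = (m - (j + 1)) * ?b"
    using binomial_absorb_comp[of m "j + 1"] binomial_absorption[of "j + 1" m] by simp
  show ?thesis
  proof (cases "m - j = 0")
    case False
    have "((m - j) * (j + 2)) * (?a * ?c) = ((m - j) * ?a) * ((j + 2) * ?c)" by (simp only: ac_simps)
    also have "\<dots> = ((j + 1) * (m - (j + 1))) * ?b\<^sup>2"
      unfolding ab[symmetric] bc power2_eq_square by (simp only: ac_simps)
    also have "\<dots> \<le> ((m - j) * (j + 2)) * ?b\<^sup>2"
      by (subst mult.commute[of "j + 1"], intro mult_mono) auto
    finally show ?thesis using False by simp
  qed (simp add: binomial_eq_0)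
qed

theorem corollary3p5:
  fixes n :: nat
  assumes "n \<ge> 1"
  shows "(\<forall>k\<in>{1..n}. num_skew_merged_inv_lis n k = (n - 1) choose (k - 1))
       \<and> num_skew_merged_inv n = 2 ^ (n - 1)
       \<and> log_concave 1 n (\<lambda>k. real (num_skew_merged_inv_lis n k))"
proof (intro conjI)
  show count: "\<forall>k\<in>{1..n}. num_skew_merged_inv_lis n k = (n - 1) choose (k - 1)"
    using num_skew_merged_inv_lis_eq by simp
  show "num_skew_merged_inv n = 2 ^ (n - 1)" by (rule num_skew_merged_inv_eq)
  show "log_concave 1 n (\<lambda>k. real (num_skew_merged_inv_lis n k))"
    unfolding log_concave_def
  proof (intro conjI ballI)
    fix k assume "k \<in> {1..n}"
    then show "0 < real (num_skew_merged_inv_lis n k)" using count diff_le_mono[of k n 1] by (simp add: zero_less_binomial)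
  next
    fix k assume k: "k \<in> {1<..<n}"
    then obtain j where j: "k = j + 2" by (auto dest: less_imp_Suc_add)
    have "num_skew_merged_inv_lis n (k - 1) * num_skew_merged_inv_lis n (k + 1)
        \<le> (num_skew_merged_inv_lis n k)\<^sup>2"
      using binomial_log_concave[of "n - 1" j] count k j by simp
    then show "real (num_skew_merged_inv_lis n (k - 1)) * real (num_skew_merged_inv_lis n (k + 1))
        \<le> (real (num_skew_merged_inv_lis n k))\<^sup>2"
      by (metis of_nat_le_iff of_nat_mult of_nat_power)
  qed
qed

end
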